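(* Consider the Kepler billiard with Kepler center $F=(0,0)$, with orbits outside a conic section boundary $\mathcal{B}_K$ whose foci are $F$ and $F'=(2\mathbf{c}_K,0)$. Let $\mathcal{K}_1$ be a Kepler ellipse (respectively hyperbola) with foci $F$ and $F_1$, and let $\mathcal{K}_1,\mathcal{K}_2,\mathcal{K}_3,\dots$ be the consecutive flight Kepler ellipses (respectively hyperbolas) of the billiard orbit starting with $\mathcal{K}_1$, where $\mathcal{K}_i$ has foci $F$ and $F_i$. Then all the second foci $F_i$ lie on a common circle centered at the second focus $F'$ of $\mathcal{B}_K$, i.e. $R:=|F'F_i|$ is independent of $i$. In particular, $R$ is a first integral of this system in addition to the energy.
   Context: Kepler billiard: a particle of mass $m>0$ moves in the plane $\mathbb{R}^2$ with Hamiltonian $H_K=\frac{p_x^2+p_y^2}{2m}+\frac{\alpha}{\sqrt{x^2+y^2}}$, $\alpha\neq 0$ (attractive if $\alpha<0$), so its unreflected orbits are arcs of conics with one focus at the Kepler center $F=(0,0)$. The boundary (mirror) is the focused conic $\mathcal{B}_K:\ \frac{(x-\mathbf{c}_K)^2}{\mathbf{a}_K^2}+\frac{y^2}{\mathbf{a}_K^2-\mathbf{c}_K^2}=1$ with foci $F=(0,0)$ and $F'=(2\mathbf{c}_K,0)$, an ellipse if $\mathbf{c}_K<\mathbf{a}_K$ (a circle with $F=F'$ if $\mathbf{c}_K=0$) and a hyperbola if $\mathbf{c}_K>\mathbf{a}_K$. "Outside" means that the particle moves on the side of $\mathcal{B}_K$ not containing the origin. When the particle hits $\mathcal{B}_K$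 at a point $P$, its velocity is reflected in the tangent line of $\mathcal{B}_K$ at $P$ (elastic reflection); otherwise it follows the Kepler flow. The $i$-th flight ellipse (hyperbola) $\mathcal{K}_i$ is the full Kepler conic containing the $i$-th orbit arc between consecutive reflections; one of its foci is $F$, and its other focus $F_i$ is called its second focus ($F_i=F$ for a circle). The energy $E$ is conserved under reflections. *)

theory Defs
  imports "HOL-Analysis.Analysis"
begin

text \<open>The plane is \<^typ>\<open>complex\<close>: \<^const>\<open>Re\<close> and \<^const>\<open>Im\<close> are the coordinates
  \<open>x\<close> and \<open>y\<close>, and the Kepler center \<open>F\<close> is \<open>0\<close>.\<close>

definition kepler_energy :: "real \<Rightarrow> real \<Rightarrow> complex \<Rightarrow> complex \<Rightarrow> real" where
  "kepler_energy m \<alpha> x y = (norm y)\<^sup>2 / (2 * m) + \<alpha> / norm x"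

text \<open>Hamilton's equations for \<^const>\<open>kepler_energy\<close> on the time interval \<open>J\<close>, with position \<open>q\<close>
  and momentum \<open>p\<close>; the force is minus the gradient of \<open>\<alpha> / norm q\<close>.\<close>

definition kepler_motion ::
    "real \<Rightarrow> real \<Rightarrow> real set \<Rightarrow> (real \<Rightarrow> complex) \<Rightarrow> (real \<Rightarrow> complex) \<Rightarrow> bool" where
  "kepler_motion m \<alpha> J q p \<longleftrightarrow>
     is_interval J \<and> interior J \<noteq> {} \<and>
     (\<forall>t\<in>J. q t \<noteq> 0 \<and>
        (q has_vector_derivative (1 / m) *\<^sub>R p t) (at t within J) \<and>
        (p has_vector_derivative (\<alpha> / norm (q t) ^ 3) *\<^sub>R q t) (at t within J))"

definition ellipse_with_foci :: "complex \<Rightarrow> complex \<Rightarrow> complex set \<Rightarrow> bool" where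
  "ellipse_with_foci f g K \<longleftrightarrow>
     (\<exists>s. dist f g < 2 * s \<and> K = {z. dist z f + dist z g = 2 * s})"

text \<open>Both branches belong to a hyperbola.\<close>

definition hyperbola_with_foci :: "complex \<Rightarrow> complex \<Rightarrow> complex set \<Rightarrow> bool" where
  "hyperbola_with_foci f g K \<longleftrightarrow>
     (\<exists>s>0. 2 * s < dist f g \<and> K = {z. \<bar>dist z f - dist z g\<bar> = 2 * s})"

text \<open>\<open>K\<close> is the full Kepler conic of the orbit arc \<open>A\<close> (a set of positions), with second focus \<open>g\<close>.
  An arc of positive duration lies on at most one such conic.\<close>

definition flight_conic :: "complex set \<Rightarrow> complex set \<Rightarrow> complex \<Rightarrow> bool" where
  "flight_conic A K g \<longleftrightarrow>
     A \<subseteq> K \<and> (ellipse_with_foci 0 g K \<or> hyperbola_with_foci 0 g K)"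

definition boundary :: "real \<Rightarrow> real \<Rightarrow> complex set" where
  "boundary a c = {z. (Re z - c)\<^sup>2 / a\<^sup>2 + (Im z)\<^sup>2 / (a\<^sup>2 - c\<^sup>2) = 1}"

definition outside_boundary :: "real \<Rightarrow> real \<Rightarrow> complex set" where
  "outside_boundary a c = - boundary a c - connected_component_set (- boundary a c) 0"

text \<open>Half the gradient of the left-hand side of the equation of the boundary.\<close>

definition boundary_normal :: "real \<Rightarrow> real \<Rightarrow> complex \<Rightarrow> complex" where
  "boundary_normal a c z = Complex ((Re z - c) / a\<^sup>2) (Im z / (a\<^sup>2 - c\<^sup>2))"

text \<open>Reflection in the tangent direction of the boundary at \<open>z\<close>. It is linear, so it acts on the
  momentum \<open>p = m v\<close> as on the velocity \<open>v\<close>.\<close>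

definition reflect_at :: "real \<Rightarrow> real \<Rightarrow> complex \<Rightarrow> complex \<Rightarrow> complex" where
  "reflect_at a c z v =
     (let n = boundary_normal a c z in v - (2 * (v \<bullet> n) / (n \<bullet> n)) *\<^sub>R n)"

text \<open>The flights of an orbit are numbered from 1; there are \<open>N\<close> of them, possibly infinitely many.\<close>

definition flights :: "enat \<Rightarrow> nat set" where
  "flights N = {i. 1 \<le> i \<and> enat i \<le> N}"

text \<open>The \<open>i\<close>-th flight takes place during the time interval \<open>J i\<close>, which contains the reflection times
  at its ends. Every flight has its own position and momentum curves, since the momentum has two values
  at a reflection: the incoming \<open>p i \<tau>\<close> and the outgoing \<open>p (Suc i) \<tau>\<close>. The first flight may start,
  and the last flight may end, away from the boundary or at infinite time.\<close>

definition kepler_billiard_orbit ::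
    "real \<Rightarrow> real \<Rightarrow> real \<Rightarrow> real \<Rightarrow> enat \<Rightarrow> (nat \<Rightarrow> real set) \<Rightarrow>
     (nat \<Rightarrow> real \<Rightarrow> complex) \<Rightarrow> (nat \<Rightarrow> real \<Rightarrow> complex) \<Rightarrow> bool" where
  "kepler_billiard_orbit m \<alpha> a c N J q p \<longleftrightarrow>
     (\<forall>i\<in>flights N. kepler_motion m \<alpha> (J i) (q i) (p i) \<and>
        (\<forall>t\<in>interior (J i). q i t \<in> outside_boundary a c)) \<and>
     (\<forall>i. i \<in> flights N \<and> Suc i \<in> flights N \<longrightarrow>
        (\<exists>\<tau>. \<tau> \<in> J i \<and> (\<forall>t\<in>J i. t \<le> \<tau>) \<and> \<tau> \<in> J (Suc i) \<and> (\<forall>t\<in>J (Suc i). \<tau> \<le> t) \<and>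
           q i \<tau> \<in> boundary a c \<and> q (Suc i) \<tau> = q i \<tau> \<and>
           p (Suc i) \<tau> = reflect_at a c (q i \<tau>) (p i \<tau>)))"

text \<open>\<open>g\<close> is the second focus of the Kepler ellipse or hyperbola traced from the phase point
  with position \<open>x\<close> and momentum \<open>y\<close>.\<close>

definition is_second_focus :: "real \<Rightarrow> real \<Rightarrow> complex \<Rightarrow> complex \<Rightarrow> complex \<Rightarrow> bool" where
  "is_second_focus m \<alpha> x y g \<longleftrightarrow>
     (\<exists>J q p K t. kepler_motion m \<alpha> J q p \<and> t \<in> J \<and> q t = x \<and> p t = y \<and> flight_conic (q ` J) K g)"

text \<open>The phase points lying on a Kepler ellipse or hyperbola. Parabolic orbits and orbits on a line
  through the Kepler center have no such conic.\<close>

definition conic_states :: "real \<Rightarrow> real \<Rightarrow> (complex \<times> complex) set" where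
  "conic_states m \<alpha> = {(x, y). \<exists>g. is_second_focus m \<alpha> x y g}"

text \<open>The quantity \<open>R\<close> as a function on \<^const>\<open>conic_states\<close>; \<open>2 * c\<close> is the second focus \<open>F'\<close>
  of the boundary.\<close>

definition second_focus_radius :: "real \<Rightarrow> real \<Rightarrow> real \<Rightarrow> complex \<Rightarrow> complex \<Rightarrow> real" where
  "second_focus_radius m \<alpha> c x y =
     dist (complex_of_real (2 * c)) (THE g. is_second_focus m \<alpha> x y g)"

text \<open>A function \<open>G\<close> on a set \<open>D\<close> of phase points is a first integral if it takes the same value at any
  two points of \<open>D\<close> on the same billiard orbit.\<close>

definition first_integral ::
    "real \<Rightarrow> real \<Rightarrow> real \<Rightarrow> real \<Rightarrow> (complex \<times> complex) set \<Rightarrow> (complex \<Rightarrow> complex \<Rightarrow> real) \<Rightarrow> bool" where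
  "first_integral m \<alpha> a c D G \<longleftrightarrow>
     (\<forall>N J q p. kepler_billiard_orbit m \<alpha> a c N J q p \<longrightarrow>
        (\<forall>i\<in>flights N. \<forall>j\<in>flights N. \<forall>s\<in>J i. \<forall>t\<in>J j.
           (q i s, p i s) \<in> D \<and> (q j t, p j t) \<in> D \<longrightarrow> G (q i s) (p i s) = G (q j t) (p j t)))"

end

theory Submission
  imports Defs
begin

text \<open>Let \<open>A\<close> be the Laplace--Runge--Lenz vector and \<open>E\<close> the energy. The second focus of a Kepler ellipse
  or hyperbola is \<open>A / (m E)\<close>, so \<open>R = norm (A - m E F') / (m \<bar>E\<bar>)\<close>. Both \<open>A\<close> and \<open>E\<close> are constant along
  a flight. At a reflection point \<open>x\<close> the norm of \<open>A - m E F'\<close> depends on the direction of the momentum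
  \<open>y\<close> only through \<open>Re (cnj ((x - F') x) y\<^sup>2)\<close>, and this is invariant under reflection because
  \<open>(x - F') x\<close> is a real multiple of the square of the normal. This covers radial and resting phase
  points as well, so the intermediate flights need not lie on ellipses or hyperbolas.\<close>

text \<open>This is the usual \<open>p \<times> L + m \<alpha> q / norm q\<close>, rewritten in complex notation with the energy.\<close>

definition runge_lenz :: "real \<Rightarrow> real \<Rightarrow> complex \<Rightarrow> complex \<Rightarrow> complex" where
  "runge_lenz m \<alpha> x y = (m * kepler_energy m \<alpha> x y) *\<^sub>R x - (1 / 2) *\<^sub>R (y\<^sup>2 * cnj x)"

section \<open>Conserved quantities of the Kepler flow\<close>

lemma kepler_energy_constant:
  assumes "m > 0" "kepler_motion m \<alpha> J q p" "s \<in> J" "t \<in> J"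
  shows "kepler_energy m \<alpha> (q s) (p s) = kepler_energy m \<alpha> (q t) (p t)"
proof -
  have J: "convex J"
    using assms(2) by (simp add: kepler_motion_def is_interval_convex_1)
  have "((\<lambda>t. kepler_energy m \<alpha> (q t) (p t)) has_derivative (\<lambda>h. 0)) (at t within J)" if "t \<in> J" for t
  proof -
    have q0: "q t \<noteq> 0" 
      and q: "(q has_derivative (\<lambda>h. h *\<^sub>R (1 / m) *\<^sub>R p t)) (at t within J)"
      and p: "(p has_derivative (\<lambda>h. h *\<^sub>R (\<alpha> / norm (q t) ^ 3) *\<^sub>R q t)) (at t within J)"
      using assms(2) that by (auto simp: kepler_motion_def has_vector_derivative_def)
    have r: "((\<lambda>t. norm (q t)) has_derivative (\<lambda>h. (h *\<^sub>R (1 / m) *\<^sub>R p t) \<bullet> sgn (q t))) (at t within J)"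
      using has_derivative_compose[OF q has_derivative_norm[OF q0]] by (simp add: o_def)
    have "norm (q t) \<noteq> 0" "2 * m \<noteq> 0" using assms(1) q0 by auto
    show ?thesis
      unfolding kepler_energy_def power2_norm_eq_inner
      by (rule has_derivative_eq_rhs, (rule derivative_intros p r \<open>norm (q t) \<noteq> 0\<close> \<open>2 * m \<noteq> 0\<close> refl)+)
        (use assms(1) q0 in \<open>simp add: fun_eq_iff sgn_div_norm divide_simps inner_commute
            power2_eq_square power3_eq_cube\<close>)
  qed
  then show ?thesis
    using has_derivative_zero_unique[OF J] assms(3,4) by blast
qed

lemma runge_lenz_constant:
  assumes "m > 0" "kepler_motion m \<alpha> J q p" "s \<in> J" "t \<in> J"
  shows "runge_lenz m \<alpha> (q s) (p s) = runge_lenz m \<alpha> (q t) (p t)"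
proof -
  have J: "convex J"
    using assms(2) by (simp add: kepler_motion_def is_interval_convex_1)
  define E where "E = kepler_energy m \<alpha> (q t) (p t)"
  \<comment> \<open>The energy is frozen at its constant value \<open>E\<close>, so that only the
    product rule is needed to differentiate \<open>A\<close>.\<close>
  define A where "A \<tau> = (m * E) *\<^sub>R q \<tau> - (1 / 2) *\<^sub>R ((p \<tau>)\<^sup>2 * cnj (q \<tau>))" for \<tau>
  have E: "kepler_energy m \<alpha> (q \<tau>) (p \<tau>) = E" if "\<tau> \<in> J" for \<tau>
    using kepler_energy_constant[OF assms(1,2) that assms(4)] by (simp add: E_def)
  have "(A has_derivative (\<lambda>h. 0)) (at \<tau> within J)" if "\<tau> \<in> J" for \<tau>
  proof -
    have q0: "q \<tau> \<noteq> 0" 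
      and q: "(q has_vector_derivative (1 / m) *\<^sub>R p \<tau>) (at \<tau> within J)"
      and p: "(p has_vector_derivative (\<alpha> / norm (q \<tau>) ^ 3) *\<^sub>R q \<tau>) (at \<tau> within J)"
      using assms(2) that by (auto simp: kepler_motion_def)
    have cq: "((\<lambda>t. cnj (q t)) has_vector_derivative cnj ((1 / m) *\<^sub>R p \<tau>)) (at \<tau> within J)"
      using q by (rule has_vector_derivative_cnj)
    define \<kappa> where "\<kappa> = \<alpha> / norm (q \<tau>) ^ 3"
    have "(A has_vector_derivative ((m * E) *\<^sub>R ((1 / m) *\<^sub>R p \<tau>)
         - (1 / 2) *\<^sub>R ((p \<tau> * p \<tau>) * cnj ((1 / m) *\<^sub>R p \<tau>)
         + (p \<tau> * (\<kappa> *\<^sub>R q \<tau>) + (\<kappa> *\<^sub>R q \<tau>) * p \<tau>) * cnj (q \<tau>)))) (at \<tau> within J)"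
      (is "(_ has_vector_derivative ?D) _")
      unfolding A_def power2_eq_square \<kappa>_def
      by (intro has_vector_derivative_diff has_vector_derivative_mult q p cq
            bounded_linear.has_vector_derivative[OF bounded_linear_scaleR_right])
    \<comment> \<open>The coefficient of \<open>p \<tau>\<close> is \<open>E\<close> minus the
      current energy, because \<open>\<kappa>\<close> times the squared distance is the
      potential.\<close>
    also have "?D = (E - ((norm (p \<tau>))\<^sup>2 / (2 * m) + \<kappa> * (norm (q \<tau>))\<^sup>2)) *\<^sub>R p \<tau>"
      using assms(1) unfolding cmod_power2
      by (simp add: complex_eq_iff field_simps power2_eq_square)
    also have "\<dots> = 0"
      using E[OF that] q0 by (simp add: \<kappa>_def kepler_energy_def power2_eq_square power3_eq_cube)
    finally show ?thesis
      by (simp add: has_vector_derivative_def)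
  qed
  then have "A s = A t"
    using has_derivative_zero_unique[OF J] assms(3,4) by blast
  then show ?thesis
    using E[OF assms(3)] by (simp add: A_def runge_lenz_def E_def)
qed

section \<open>Effect of a reflection\<close>

lemma norm_reflect_at: "norm (reflect_at a c z v) = norm v"
\<comment> \<open>Where the normal vanishes, \<open>reflect_at\<close> is the identity.\<close>
proof (cases "boundary_normal a c z = 0")
  case False
  define n where "n = boundary_normal a c z"
  have "n \<bullet> n \<noteq> 0" using False by (simp add: n_def)
  then have "reflect_at a c z v \<bullet> reflect_at a c z v = v \<bullet> v"
    unfolding reflect_at_def n_def[symmetric] Let_def
    by (simp add: algebra_simps inner_commute power2_eq_square divide_simps)
  then show ?thesis by (simp add: norm_eq_sqrt_inner)
qed (simp add: reflect_at_def)

lemma kepler_energy_reflect_at: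
  "kepler_energy m \<alpha> x (reflect_at a c z y) = kepler_energy m \<alpha> x y"
  by (simp add: kepler_energy_def norm_reflect_at)

text \<open>Equality of arguments modulo \<open>\<pi>\<close> of \<open>(z - F') z\<close> and \<open>n\<^sup>2\<close>: the normal \<open>n\<close> bisects an angle
  between the lines from \<open>z\<close> to the foci.\<close>

lemma boundary_normal_bisects:
  assumes "a > 0" "c \<ge> 0" "c \<noteq> a" "z \<in> boundary a c"
  shows "Im ((z - of_real (2 * c)) * z * cnj ((boundary_normal a c z)\<^sup>2)) = 0"
proof -
  \<comment> \<open>\<open>b\<close> is positive for an ellipse and negative for a hyperbola; since
    only \<open>b \<noteq> 0\<close> enters, one computation serves both.\<close>
  define b where "b = a\<^sup>2 - c\<^sup>2"
  define X where "X = Re z - c"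
  define y where "y = Im z"
  have b: "b \<noteq> 0" using assms by (simp add: b_def power2_eq_iff)
  have eq: "X\<^sup>2 / a\<^sup>2 + y\<^sup>2 / b = 1"
    using assms(4) by (simp add: boundary_def X_def y_def b_def)
  have c2: "c\<^sup>2 = a\<^sup>2 - b" by (simp add: b_def)
  have z: "z = Complex (X + c) y" by (simp add: X_def y_def complex_eq_iff)
  have "Im ((z - of_real (2 * c)) * z * cnj ((boundary_normal a c z)\<^sup>2)) =
    2 * X * y * (X\<^sup>2 / a\<^sup>2 / a\<^sup>2 - y\<^sup>2 / b / b + (c\<^sup>2 - X\<^sup>2 + y\<^sup>2) / (a\<^sup>2 * b))"
    unfolding boundary_normal_def X_def[symmetric] b_def[symmetric] y_def[symmetric]
    using b assms(1) by (simp add: z) (simp add: field_simps power2_eq_square power4_eq_xxxx)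
  \<comment> \<open>Substituting for \<open>c\<^sup>2\<close> makes the bracket a multiple of the
    defect in the boundary equation.\<close>
  also have "X\<^sup>2 / a\<^sup>2 / a\<^sup>2 - y\<^sup>2 / b / b + (c\<^sup>2 - X\<^sup>2 + y\<^sup>2) / (a\<^sup>2 * b)
     = (1 / b - 1 / a\<^sup>2) * (1 - (X\<^sup>2 / a\<^sup>2 + y\<^sup>2 / b))"
    unfolding c2 using b assms(1) by (simp add: field_simps power2_eq_square)
  finally show ?thesis by (simp add: eq)
qed

text \<open>The assumption makes \<open>w\<close> a real multiple of the square of the normal
  \<open>n\<close>. The real part then depends on \<open>v\<close> only through its norm and the
  square of \<open>v \<bullet> n\<close>, and reflection merely flips the sign of
  \<open>v \<bullet> n\<close>.\<close>

lemma Re_square_reflect_at: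
  assumes "Im (w * cnj ((boundary_normal a c z)\<^sup>2)) = 0"
  shows "Re (cnj w * (reflect_at a c z v)\<^sup>2) = Re (cnj w * v\<^sup>2)"
proof (cases "boundary_normal a c z = 0")
  case False
  define n where "n = boundary_normal a c z"
  define l where "l = Re (w * cnj (n\<^sup>2))"
  define k where "k = l / norm n ^ 4"
  define r where "r = reflect_at a c z v"
  have n: "n \<noteq> 0" using False by (simp add: n_def)
  have "w * cnj (n\<^sup>2) = of_real l"
    using assms by (simp add: complex_eq_iff n_def l_def)
  then have "w * cnj (n\<^sup>2) * n\<^sup>2 = of_real l * n\<^sup>2"
    by simp
  moreover have "w * cnj (n\<^sup>2) * n\<^sup>2 = w * of_real (norm n ^ 4)"
    using complex_norm_square[of "n\<^sup>2"] by (simp add: norm_power mult_ac)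
  ultimately have w: "w = of_real k * n\<^sup>2"
    using n by (simp add: k_def field_simps)
  \<comment> \<open>Double-angle formula for \<open>cnj n * u\<close>, whose real part is
    \<open>u \<bullet> n\<close>.\<close>
  have *: "Re (cnj w * u\<^sup>2) = k * (2 * (u \<bullet> n)\<^sup>2 - (norm n)\<^sup>2 * (norm u)\<^sup>2)" for u
    unfolding w cmod_power2 by (simp add: inner_complex_def power2_eq_square algebra_simps)
  have "r \<bullet> n = - (v \<bullet> n)"
    using n unfolding r_def reflect_at_def n_def[symmetric] Let_def by (simp add: algebra_simps)
  then have "(r \<bullet> n)\<^sup>2 = (v \<bullet> n)\<^sup>2" by simp
  moreover have "norm r = norm v" by (simp add: r_def norm_reflect_at)
  ultimately show ?thesis unfolding r_def[symmetric] * by simp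
qed (simp add: reflect_at_def)

lemma norm_runge_lenz_reflect_at:
  assumes "a > 0" "c \<ge> 0" "c \<noteq> a" "x \<in> boundary a c"
  defines "f \<equiv> of_real (2 * c)"
  shows "norm (runge_lenz m \<alpha> x (reflect_at a c x y) - (m * kepler_energy m \<alpha> x (reflect_at a c x y)) *\<^sub>R f)
       = norm (runge_lenz m \<alpha> x y - (m * kepler_energy m \<alpha> x y) *\<^sub>R f)"
proof -
  define e where "e = m * kepler_energy m \<alpha> x y"
  \<comment> \<open>Only the last term sees the direction of \<open>v\<close>. The same
    \<open>e\<close> serves before and after the reflection, as the energy is preserved.\<close>
  have *: "(norm ((e *\<^sub>R x - (1 / 2) *\<^sub>R (v\<^sup>2 * cnj x)) - e *\<^sub>R f))\<^sup>2 =
     e\<^sup>2 * (norm (x - f))\<^sup>2 + (norm v)^4 * (norm x)\<^sup>2 / 4 - e * Re (cnj ((x - f) * x) * v\<^sup>2)" for v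
  proof -
    have v4: "norm v ^ 4 = ((norm v)\<^sup>2)\<^sup>2" by simp
    show ?thesis unfolding v4 unfolding cmod_power2 
      by (simp add: f_def field_simps power2_eq_square)
  qed
  have "Re (cnj ((x - f) * x) * (reflect_at a c x y)\<^sup>2) = Re (cnj ((x - f) * x) * y\<^sup>2)"
    unfolding f_def by (intro Re_square_reflect_at boundary_normal_bisects assms)
  then have "(norm ((e *\<^sub>R x - (1 / 2) *\<^sub>R ((reflect_at a c x y)\<^sup>2 * cnj x)) - e *\<^sub>R f))\<^sup>2 =
     (norm ((e *\<^sub>R x - (1 / 2) *\<^sub>R (y\<^sup>2 * cnj x)) - e *\<^sub>R f))\<^sup>2"
    by (simp only: * norm_reflect_at)
  then show ?thesis
    unfolding runge_lenz_def kepler_energy_reflect_at e_def[symmetric]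
    by (rule power2_eq_imp_eq) (rule norm_ge_zero)+
qed

section \<open>The second focus in terms of the Runge-Lenz vector and the energy\<close>

text \<open>Nonempty interior makes every point of \<open>J\<close> a limit point, so derivatives
  within \<open>J\<close> are unique even at reflection times, where they are one-sided.\<close>

lemma derivative_of_zero_on_interval:
  fixes f :: "real \<Rightarrow> real"
  assumes "is_interval J" "interior J \<noteq> {}" "t \<in> J" "\<And>s. s \<in> J \<Longrightarrow> f s = 0"
    "(f has_real_derivative D) (at t within J)"
  shows "D = 0"
proof -
  have "\<nexists>x. J = {x}" using assms(2) by auto
  then have "at t within J \<noteq> bot"
    using connected_imp_perfect[of J t] assms(1,3)
    by (simp add: trivial_limit_within is_interval_connected)
  moreover have "(f has_vector_derivative 0) (at t within J)"
    using has_vector_derivative_const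
    by (rule has_vector_derivative_transform[OF assms(3), rotated]) (use assms(4) in auto)
  ultimately show ?thesis
    using vector_derivative_unique_within assms(5)
    by (metis has_real_derivative_iff_has_vector_derivative)
qed

text \<open>Squaring the focal condition cancels the quadratic terms and leaves an equation linear
  in \<open>q t\<close> and its norm. The norm of \<open>u\<close> is the eccentricity and
  \<open>k\<close> is the signed semi-latus rectum; \<open>s\<close> is negative on the hyperbola
  branch around the origin.\<close>

lemma flight_conic_focal_equation:
  assumes "flight_conic (q ` J) K g" "connected J" "continuous_on J q"
  shows "\<exists>s u k.  g = (2 * s) *\<^sub>R u \<and> k = s * (1 - (norm u)\<^sup>2) \<and> k \<noteq> 0 \<and>
    (\<forall>t\<in>J. norm (q t) = u \<bullet> q t + k)"
proof -
  have *: ?thesis if "s \<noteq> 0" "norm g \<noteq> 2 * \<bar>s\<bar>" and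
    d: "\<And>t. t \<in> J \<Longrightarrow> (norm (q t - g))\<^sup>2 = (2 * s - norm (q t))\<^sup>2" for s
  proof (intro exI conjI ballI)
    define u where "u = (1 / (2 * s)) *\<^sub>R g"
    show g: "g = (2 * s) *\<^sub>R u" using \<open>s \<noteq> 0\<close> by (simp add: u_def)
    show "s * (1 - (norm u)\<^sup>2) = s * (1 - (norm u)\<^sup>2)" by (rule refl)
    have "norm g = 2 * \<bar>s\<bar> * norm u" by (simp add: g abs_mult)
    then have "norm u \<noteq> 1" using that(2) by auto
    then have "(norm u)\<^sup>2 \<noteq> 1" 
      by (metis norm_ge_zero one_power2 power2_eq_iff_nonneg zero_le_one)
    then show "s * (1 - (norm u)\<^sup>2) \<noteq> 0" using that(1) by simp
    fix t assume "t \<in> J"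
    from d[OF this] have "4 * s * norm (q t) = 4 * s * (u \<bullet> q t + s * (1 - (norm u)\<^sup>2))"
      unfolding g power2_norm_eq_inner
      by (simp add: power2_diff inner_diff inner_commute power2_norm_eq_inner algebra_simps power2_eq_square)
         (simp add: norm_eq_sqrt_inner)
    then show "norm (q t) = u \<bullet> q t + s * (1 - (norm u)\<^sup>2)" using that(1) by simp
  qed
  have sub: "q ` J \<subseteq> K" and "ellipse_with_foci 0 g K \<or> hyperbola_with_foci 0 g K"
    using assms(1) by (auto simp: flight_conic_def)
  then consider (e) "ellipse_with_foci 0 g K" | (h) "hyperbola_with_foci 0 g K" by blast
  then show ?thesis
  proof cases
    case e
    then obtain s where s: "norm g < 2 * s" "K = {z. norm z + dist z g = 2 * s}"
      by (auto simp: ellipse_with_foci_def)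
    then have "norm (q t) + norm (q t - g) = 2 * s" if "t \<in> J" for t
      using sub that by (auto simp: dist_norm)
    then have "norm (q t - g) = 2 * s - norm (q t)" if "t \<in> J" for t
      using that by fastforce
    moreover have "s > 0" using s(1) norm_ge_zero[of g] by linarith
    ultimately show ?thesis using *[of s] s(1) by simp
  next
    case h
    then obtain s where s: "s > 0" "norm g > 2 * s" "K = {z. \<bar>norm z - dist z g\<bar> = 2 * s}"
      by (auto simp: hyperbola_with_foci_def)
    define f where "f t = norm (q t) - norm (q t - g)" for t
    have f: "f t = 2 * s \<or> f t = - 2 * s" if "t \<in> J" for t
      using sub that s by (auto simp: dist_norm f_def)
    \<comment> \<open>An arc cannot switch branches: a connected image inside two values has at most
      one point.\<close>
    have "connected (f ` J)"
      unfolding f_def by (intro connected_continuous_image continuous_intros assms)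
    moreover have "f ` J \<subseteq> {2 * s, - 2 * s}" using f by auto
    ultimately have "\<exists>x. f ` J \<subseteq> {x}"
      by (metis connected_finite_iff_sing empty_subsetI finite.emptyI finite_insert finite_subset subset_refl)
    then obtain x where x: "f ` J \<subseteq> {x}" ..
    show ?thesis
    proof (cases "J = {}")
      case True
      then show ?thesis using *[of s] s by simp
    next
      case False
      then obtain \<sigma> where \<sigma>: "\<bar>\<sigma>\<bar> = s" "x = 2 * \<sigma>" using f x s(1)
        by (metis abs_minus_cancel abs_of_pos all_not_in_conv image_eqI mult_minus_left mult_minus_right singletonD subsetD)
      have "(norm (q t - g))\<^sup>2 = (2 * \<sigma> - norm (q t))\<^sup>2" if "t \<in> J" for t
      proof -
        have "f t = 2 * \<sigma>" using x that \<sigma> by auto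
        then have "norm (q t - g) = - (2 * \<sigma> - norm (q t))" by (simp add: f_def)
        then show ?thesis by (metis power2_minus)
      qed
      then show ?thesis using *[of \<sigma>] \<sigma> s by auto
    qed
  qed
qed

text \<open>The Gram expression is the squared angular momentum. The first two identities pin down
  the vector when it is nonzero; the third gives its length and so the eccentricity.\<close>

lemma runge_lenz_inner:
  assumes "m > 0" "x \<noteq> 0"
  shows "runge_lenz m \<alpha> x y \<bullet> x = (norm x)\<^sup>2 * (norm y)\<^sup>2 - (x \<bullet> y)\<^sup>2 + m * \<alpha> * norm x"
    and "runge_lenz m \<alpha> x y \<bullet> y = m * \<alpha> * (x \<bullet> y) / norm x"
    and "(norm (runge_lenz m \<alpha> x y))\<^sup>2 =
      2 * m * kepler_energy m \<alpha> x y * ((norm x)\<^sup>2 * (norm y)\<^sup>2 - (x \<bullet> y)\<^sup>2) + (m * \<alpha>)\<^sup>2"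
proof -
  define e where "e = m * kepler_energy m \<alpha> x y"
  define r where "r = norm x"
  define P where "P = (norm y)\<^sup>2"
  have r: "r > 0" using assms by (simp add: r_def)
  have r2: "r\<^sup>2 = (Re x)\<^sup>2 + (Im x)\<^sup>2" by (simp add: r_def cmod_power2)
  have P: "P = (Re y)\<^sup>2 + (Im y)\<^sup>2" by (simp add: P_def cmod_power2)
  have e: "e = P / 2 + m * \<alpha> / r"
    using assms by (simp add: e_def kepler_energy_def r_def P_def field_simps)
  have A: "runge_lenz m \<alpha> x y = e *\<^sub>R x - (1 / 2) *\<^sub>R (y\<^sup>2 * cnj x)"
    by (simp add: runge_lenz_def e_def)
  have "runge_lenz m \<alpha> x y \<bullet> x = e * r\<^sup>2 - (x \<bullet> y)\<^sup>2 + r\<^sup>2 * P / 2"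
    unfolding A r2 P by (simp add: inner_complex_def field_simps power2_eq_square)
  also have "\<dots> = r\<^sup>2 * P - (x \<bullet> y)\<^sup>2 + m * \<alpha> * r"
    using r by (simp add: e field_simps power2_eq_square)
  finally show "runge_lenz m \<alpha> x y \<bullet> x = (norm x)\<^sup>2 * (norm y)\<^sup>2 - (x \<bullet> y)\<^sup>2 + m * \<alpha> * norm x"
    by (simp only: r_def P_def)
  have "runge_lenz m \<alpha> x y \<bullet> y = (e - P / 2) * (x \<bullet> y)"
    unfolding A P by (simp add: inner_complex_def field_simps power2_eq_square)
  then show "runge_lenz m \<alpha> x y \<bullet> y = m * \<alpha> * (x \<bullet> y) / norm x"
    by (simp add: e r_def)
  have "(norm (runge_lenz m \<alpha> x y))\<^sup>2 = 
      2 * e * (r\<^sup>2 * P - (x \<bullet> y)\<^sup>2) + ((e - P / 2) * r)\<^sup>2"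
    unfolding A cmod_power2 P power_mult_distrib r2
    by (simp add: inner_complex_def field_simps power2_eq_square)
  also have "(e - P / 2) * r = m * \<alpha>" using r by (simp add: e)
  finally show "(norm (runge_lenz m \<alpha> x y))\<^sup>2 =
      2 * m * kepler_energy m \<alpha> x y * ((norm x)\<^sup>2 * (norm y)\<^sup>2 - (x \<bullet> y)\<^sup>2) + (m * \<alpha>)\<^sup>2"
    by (simp add: e_def r_def P_def)
qed

text \<open>The Gram expression is the squared determinant of \<open>x\<close> and \<open>y\<close>,
  so these form a basis of the plane.\<close>

lemma complex_eq_of_inner_eq:
  fixes v w x y :: complex
  assumes "(norm x)\<^sup>2 * (norm y)\<^sup>2 - (x \<bullet> y)\<^sup>2 \<noteq> 0" "v \<bullet> x = w \<bullet> x" "v \<bullet> y = w \<bullet> y"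
  shows "v = w"
proof -
  define L where "L = Re x * Im y - Im x * Re y"
  have "(norm x)\<^sup>2 * (norm y)\<^sup>2 - (x \<bullet> y)\<^sup>2 = L\<^sup>2"
    unfolding cmod_power2 L_def by (simp add: inner_complex_def algebra_simps power2_eq_square)
  then have "L \<noteq> 0" using assms(1) by auto
  define d where "d = v - w"
  have d: "Re d * Re x + Im d * Im x = 0" "Re d * Re y + Im d * Im y = 0"
    using assms(2,3) by (simp_all add: d_def inner_complex_def algebra_simps)
  \<comment> \<open>Cramer's rule for the system \<open>d\<close>.\<close>
  have "Re d * L = Im y * (Re d * Re x + Im d * Im x) - Im x * (Re d * Re y + Im d * Im y)"
    "Im d * L = Re x * (Re d * Re y + Im d * Im y) - Re y * (Re d * Re x + Im d * Im x)"
    by (simp_all add: L_def algebra_simps)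
  then have "d = 0" using \<open>L \<noteq> 0\<close> unfolding d by (simp add: complex_eq_iff)
  then show ?thesis by (simp add: d_def)
qed

text \<open>Differentiating the focal equation \<open>norm q = u \<bullet> q + k\<close> of the conic twice along the flow gives
  \<open>L\<^sup>2 = - m \<alpha> k\<close> for the angular momentum \<open>L\<close>, which rules out radial motion.\<close>

lemma second_focus_runge_lenz:
  assumes "m > 0" "\<alpha> \<noteq> 0" "is_second_focus m \<alpha> x y g"
  shows "kepler_energy m \<alpha> x y \<noteq> 0"
    and "runge_lenz m \<alpha> x y = (m * kepler_energy m \<alpha> x y) *\<^sub>R g"
proof -
  from assms(3) obtain J q p K t where M: "kepler_motion m \<alpha> J q p" and t: "t \<in> J" "q t = x" "p t = y"
    and C: "flight_conic (q ` J) K g"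
    by (auto simp: is_second_focus_def)
  have J: "is_interval J" "interior J \<noteq> {}" and
    M': "\<And>t. t \<in> J \<Longrightarrow> q t \<noteq> 0"
     "\<And>t. t \<in> J \<Longrightarrow> (q has_vector_derivative (1 / m) *\<^sub>R p t) (at t within J)"
     "\<And>t. t \<in> J \<Longrightarrow> (p has_vector_derivative (\<alpha> / norm (q t) ^ 3) *\<^sub>R q t) (at t within J)"
    using M by (auto simp: kepler_motion_def)
  have "continuous_on J q"
    using M'(2) by (meson continuous_on_eq_continuous_within has_vector_derivative_continuous)
  with C J(1) obtain s u k where g: "g = (2 * s) *\<^sub>R u" and k: "k = s * (1 - (norm u)\<^sup>2)" "k \<noteq> 0"
    and q: "\<And>t. t \<in> J \<Longrightarrow> norm (q t) = u \<bullet> q t + k"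
    by (metis flight_conic_focal_equation is_interval_connected)
  \<comment> \<open>First derivative of the squared focal equation; squaring avoids differentiating
    the norm.\<close>
  have "(2 / m) * (q t \<bullet> p t - (u \<bullet> q t + k) * (u \<bullet> p t)) = 0" if "t \<in> J" for t
  proof (rule derivative_of_zero_on_interval[OF J that])
    show "q s \<bullet> q s - (u \<bullet> q s + k)\<^sup>2 = 0" if "s \<in> J" for s
      by (simp add: q[OF that, symmetric] power2_norm_eq_inner)
    show "((\<lambda>s. q s \<bullet> q s - (u \<bullet> q s + k)\<^sup>2) has_real_derivative
       (2 / m) * (q t \<bullet> p t - (u \<bullet> q t + k) * (u \<bullet> p t))) (at t within J)"
      using M'(2)[OF that] unfolding has_vector_derivative_def has_field_derivative_def
      by (auto intro!: derivative_eq_intros simp: fun_eq_iff inner_commute algebra_simps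
            add_divide_distrib diff_divide_distrib)
  qed
  then have qp: "q t \<bullet> p t - (u \<bullet> q t + k) * (u \<bullet> p t) = 0" if "t \<in> J" for t
    using assms(1) that by fastforce
  define r where "r = norm x"
  have r: "r > 0" using M'(1) t by (auto simp: r_def)
  have ux: "u \<bullet> x = r - k" using q[OF t(1)] by (simp add: t r_def)
  \<comment> \<open>Second derivative, taken from \<open>qp\<close>, which holds on all of
    \<open>J\<close>.\<close>
  have "p t \<bullet> p t / m + \<alpha> / norm (q t) ^ 3 * (q t \<bullet> q t) - (u \<bullet> p t)\<^sup>2 / m 
      - (u \<bullet> q t + k) * (\<alpha> / norm (q t) ^ 3 * (u \<bullet> q t)) = 0"
  proof (rule derivative_of_zero_on_interval[OF J t(1) qp])
    show "((\<lambda>t. q t \<bullet> p t - (u \<bullet> q t + k) * (u \<bullet> p t)) has_real_derivative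
      p t \<bullet> p t / m + \<alpha> / norm (q t) ^ 3 * (q t \<bullet> q t) - (u \<bullet> p t)\<^sup>2 / m 
      - (u \<bullet> q t + k) * (\<alpha> / norm (q t) ^ 3 * (u \<bullet> q t))) (at t within J)"
      using M'(2,3)[OF t(1)] unfolding has_vector_derivative_def has_field_derivative_def
      by (auto intro!: derivative_eq_intros simp: fun_eq_iff inner_commute power2_eq_square algebra_simps
            add_divide_distrib diff_divide_distrib)
  qed
  then have D2: "(norm y)\<^sup>2 / m + \<alpha> / r ^ 3 * r\<^sup>2 - (u \<bullet> y)\<^sup>2 / m - r * (\<alpha> / r ^ 3 * (r - k)) = 0"
    by (simp add: t r_def[symmetric] ux flip: power2_norm_eq_inner)
  have uy: "x \<bullet> y = r * (u \<bullet> y)" using qp[OF t(1)] ux by (simp add: t)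
  define E where "E = kepler_energy m \<alpha> x y"
  define A where "A = runge_lenz m \<alpha> x y"
  define L2 where "L2 = (norm x)\<^sup>2 * (norm y)\<^sup>2 - (x \<bullet> y)\<^sup>2"
  have "L2 + m * \<alpha> * k = (m * r\<^sup>2) *
      ((norm y)\<^sup>2 / m + \<alpha> / r ^ 3 * r\<^sup>2 - (u \<bullet> y)\<^sup>2 / m - r * (\<alpha> / r ^ 3 * (r - k)))"
    using r assms(1) unfolding L2_def uy r_def[symmetric]
    by (simp add: field_simps power2_eq_square power3_eq_cube)
  then have L2: "L2 = - m * \<alpha> * k"
    unfolding D2 by simp
  have x: "x \<noteq> 0" using r by (auto simp: r_def)
  note A = runge_lenz_inner[OF assms(1) x, of \<alpha> y, folded A_def E_def L2_def r_def]
  have Au: "A = (m * \<alpha>) *\<^sub>R u"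
  proof (rule complex_eq_of_inner_eq[of x y])
    show "(norm x)\<^sup>2 * (norm y)\<^sup>2 - (x \<bullet> y)\<^sup>2 \<noteq> 0"
      unfolding L2_def[symmetric] L2 using assms(1,2) k by simp
    show "A \<bullet> x = (m * \<alpha>) *\<^sub>R u \<bullet> x" unfolding A L2 by (simp add: ux algebra_simps)
    show "A \<bullet> y = (m * \<alpha>) *\<^sub>R u \<bullet> y" unfolding A uy using r by simp
  qed
  \<comment> \<open>Comparing the two expressions for the squared length of \<open>A\<close> yields
    the classical relation between energy and major axis,
    \<open>\<alpha> = 2 * E * s\<close>.\<close>
  have "(m * \<alpha>)\<^sup>2 * (norm u)\<^sup>2 = 2 * m * E * (- m * \<alpha> * k) + (m * \<alpha>)\<^sup>2"
    using A(3) unfolding L2 Au by (simp add: power_mult_distrib)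
  then have "m\<^sup>2 * \<alpha> * (1 - (norm u)\<^sup>2) * (\<alpha> - 2 * E * s) = 0"
    unfolding k by (simp add: algebra_simps power2_eq_square)
  then have Es: "\<alpha> = 2 * E * s"
    using assms(1,2) k by auto
  then show "kepler_energy m \<alpha> x y \<noteq> 0" using assms(2) by (auto simp: E_def)
  show "runge_lenz m \<alpha> x y = (m * kepler_energy m \<alpha> x y) *\<^sub>R g"
    using Au unfolding A_def[symmetric] E_def[symmetric] g by (simp add: Es)
qed

lemma second_focus_radius_eq:
  assumes "m > 0" "\<alpha> \<noteq> 0" "is_second_focus m \<alpha> x y g"
  shows "second_focus_radius m \<alpha> c x y = dist (of_real (2 * c)) g"
    and "dist (of_real (2 * c)) g = norm (runge_lenz m \<alpha> x y - (m * kepler_energy m \<alpha> x y) *\<^sub>R of_real (2 * c))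
      / (m * \<bar>kepler_energy m \<alpha> x y\<bar>)"
proof -
  note E = second_focus_runge_lenz[OF assms(1,2)]
  \<comment> \<open>Nonzero energy determines the focus from the phase point, so the description
    \<open>THE\<close> is well defined.\<close>
  have "g' = g" if "is_second_focus m \<alpha> x y g'" for g'
    using E(2)[OF that] E[OF assms(3)] assms(1) by auto
  then have "(THE g. is_second_focus m \<alpha> x y g) = g"
    using assms(3) by blast
  then show "second_focus_radius m \<alpha> c x y = dist (of_real (2 * c)) g"
    by (simp add: second_focus_radius_def)
  have "norm (runge_lenz m \<alpha> x y - (m * kepler_energy m \<alpha> x y) *\<^sub>R of_real (2 * c)) =
      m * \<bar>kepler_energy m \<alpha> x y\<bar> * dist (of_real (2 * c)) g"
    unfolding E(2)[OF assms(3)] scaleR_diff_right[symmetric] norm_scaleR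
    using assms(1) by (simp add: abs_mult dist_norm norm_minus_commute)
  then show "dist (of_real (2 * c)) g = norm (runge_lenz m \<alpha> x y - (m * kepler_energy m \<alpha> x y) *\<^sub>R of_real (2 * c))
      / (m * \<bar>kepler_energy m \<alpha> x y\<bar>)"
    using assms(1) E(1)[OF assms(3)] by (simp del: of_real_mult)
qed

section \<open>First integrals of the billiard\<close>

text \<open>Induction on the flight number: the reflection time belongs to both neighbouring flights
  and hands the value of \<open>G\<close> over. Working on \<open>UNIV\<close> lets the chain pass
  through arbitrary intermediate phase points.\<close>

lemma first_integralI:
  assumes flow: "\<And>J q p s t. kepler_motion m \<alpha> J q p \<Longrightarrow> s \<in> J \<Longrightarrow> t \<in> J \<Longrightarrow> G (q s) (p s) = G (q t) (p t)"
    and refl: "\<And>x y. x \<in> boundary a c \<Longrightarrow> G x (reflect_at a c x y) = G x y"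
  shows "first_integral m \<alpha> a c UNIV G"
proof -
  have "G (q i s) (p i s) = G (q j t) (p j t)"
    if orb: "kepler_billiard_orbit m \<alpha> a c N J q p" and "i \<le> j" 
      and "i \<in> flights N" "j \<in> flights N" "s \<in> J i" "t \<in> J j" for N J q p i j s t
    using that(2-)
  proof (induction j arbitrary: t rule: dec_induct)
    case base
    then show ?case using orb by (auto simp: kepler_billiard_orbit_def intro: flow)
  next
    case (step j)
    have j: "j \<in> flights N"
      using step by (auto simp: flights_def) (metis Suc_ile_eq order_less_imp_le)
    then obtain \<tau> where \<tau>: "\<tau> \<in> J j" "\<tau> \<in> J (Suc j)" "q j \<tau> \<in> boundary a c" 
      "q (Suc j) \<tau> = q j \<tau>" "p (Suc j) \<tau> = reflect_at a c (q j \<tau>) (p j \<tau>)"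
      using orb step.prems unfolding kepler_billiard_orbit_def by blast
    have "G (q i s) (p i s) = G (q j \<tau>) (p j \<tau>)"
      using step j \<tau> by blast
    also have "\<dots> = G (q (Suc j) \<tau>) (p (Suc j) \<tau>)"
      using \<tau> refl by simp
    also have "\<dots> = G (q (Suc j) t) (p (Suc j) t)"
      using orb step.prems \<tau>(2) by (intro flow[of "J (Suc j)"]) (auto simp: kepler_billiard_orbit_def)
    finally show ?case .
  qed
  \<comment> \<open>The claim is symmetric in the two flights, so \<open>i \<le> j\<close> loses
    nothing.\<close>
  then show ?thesis
    unfolding first_integral_def by (metis nat_le_linear)
qed

lemma first_integralD:
  assumes "first_integral m \<alpha> a c D G" "kepler_billiard_orbit m \<alpha> a c N J q p"
    "i \<in> flights N" "j \<in> flights N" "s \<in> J i" "t \<in> J j"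
    "(q i s, p i s) \<in> D" "(q j t, p j t) \<in> D"
  shows "G (q i s) (p i s) = G (q j t) (p j t)"
  using assms unfolding first_integral_def by blast

theorem theorem3p2:
  fixes m \<alpha> a c :: real
    and N :: enat
    and J :: "nat \<Rightarrow> real set"
    and q p :: "nat \<Rightarrow> real \<Rightarrow> complex"
    and K :: "nat \<Rightarrow> complex set"
    and F :: "nat \<Rightarrow> complex"
  assumes "m > 0" and "\<alpha> \<noteq> 0"
    and "a > 0" and "c \<ge> 0" and "c \<noteq> a"
    and "kepler_billiard_orbit m \<alpha> a c N J q p"
    and "\<And>i. i \<in> flights N \<Longrightarrow> flight_conic (q i ` J i) (K i) (F i)"
  shows "(\<exists>R. (\<forall>i\<in>flights N. F i \<in> sphere (complex_of_real (2 * c)) R) \<and>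
             (\<forall>i\<in>flights N. \<forall>t\<in>J i. second_focus_radius m \<alpha> c (q i t) (p i t) = R)) \<and>
         first_integral m \<alpha> a c (conic_states m \<alpha>) (second_focus_radius m \<alpha> c) \<and>
         first_integral m \<alpha> a c UNIV (kepler_energy m \<alpha>)"
proof -
  let ?E = "kepler_energy m \<alpha>"
  let ?W = "\<lambda>x y. norm (runge_lenz m \<alpha> x y - (m * ?E x y) *\<^sub>R complex_of_real (2 * c))"
  have E: "first_integral m \<alpha> a c UNIV ?E"
    by (rule first_integralI) (rule kepler_energy_constant[OF assms(1)] kepler_energy_reflect_at; assumption?)+
  have W: "first_integral m \<alpha> a c UNIV ?W"
  proof (rule first_integralI)
    show "?W (q s) (p s) = ?W (q t) (p t)" if "kepler_motion m \<alpha> J q p" "s \<in> J" "t \<in> J" for J q p s t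
      using kepler_energy_constant[OF assms(1) that] runge_lenz_constant[OF assms(1) that] by simp
    show "?W x (reflect_at a c x y) = ?W x y" if "x \<in> boundary a c" for x y
      using norm_runge_lenz_reflect_at[OF assms(3-5) that] .
  qed
  have rad: "second_focus_radius m \<alpha> c x y = ?W x y / (m * \<bar>?E x y\<bar>)"
    if "(x, y) \<in> conic_states m \<alpha>" for x y
  proof -
    from that obtain g where "is_second_focus m \<alpha> x y g" by (auto simp: conic_states_def)
    then show ?thesis
      using second_focus_radius_eq[OF assms(1,2)] by (metis (no_types))
  qed
  \<comment> \<open>The radius is controlled only on \<open>conic_states\<close>, so its invariance
    is read off from \<open>?W\<close> and \<open>?E\<close>, which are invariant
    everywhere.\<close>
  have R: "first_integral m \<alpha> a c (conic_states m \<alpha>) (second_focus_radius m \<alpha> c)"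
    unfolding first_integral_def
  proof (intro allI impI ballI, elim conjE)
    fix N J q p i j s t
    assume *: "kepler_billiard_orbit m \<alpha> a c N J q p" "i \<in> flights N" "j \<in> flights N" "s \<in> J i" "t \<in> J j"
      and D: "(q i s, p i s) \<in> conic_states m \<alpha>" "(q j t, p j t) \<in> conic_states m \<alpha>"
    have "?E (q i s) (p i s) = ?E (q j t) (p j t)"
      by (rule first_integralD[OF E * UNIV_I UNIV_I])
    moreover have "?W (q i s) (p i s) = ?W (q j t) (p j t)"
      by (rule first_integralD[OF W * UNIV_I UNIV_I])
    ultimately show "second_focus_radius m \<alpha> c (q i s) (p i s) = second_focus_radius m \<alpha> c (q j t) (p j t)"
      by (simp only: rad[OF D(1)] rad[OF D(2)])
  qed
  \<comment> \<open>The flight itself is the witnessing motion.\<close>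
  have foc: "is_second_focus m \<alpha> (q i t) (p i t) (F i)" if "i \<in> flights N" "t \<in> J i" for i t
    using assms(6,7) that unfolding is_second_focus_def kepler_billiard_orbit_def by blast
  have ne: "\<exists>t. t \<in> J i" if "i \<in> flights N" for i
    using assms(6) that interior_subset[of "J i"]
    by (fastforce simp: kepler_billiard_orbit_def kepler_motion_def)
  have "\<exists>R. \<forall>i\<in>flights N. \<forall>t\<in>J i. second_focus_radius m \<alpha> c (q i t) (p i t) = R"
  \<comment> \<open>With no flights any \<open>R\<close> works; otherwise \<open>R\<close> is the
    radius at one chosen phase point.\<close>
  proof (cases "flights N = {}")
    case False
    then obtain j s where j: "j \<in> flights N" "s \<in> J j" using ne by blast
    have D: "(q i t, p i t) \<in> conic_states m \<alpha>" if "i \<in> flights N" "t \<in> J i" for i t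
      using foc[OF that] by (auto simp: conic_states_def)
    show ?thesis
    proof (intro exI ballI)
      fix i t
      assume it: "i \<in> flights N" "t \<in> J i"
      show "second_focus_radius m \<alpha> c (q i t) (p i t) = second_focus_radius m \<alpha> c (q j s) (p j s)"
        by (rule first_integralD[OF R assms(6) it(1) j(1) it(2) j(2) D[OF it] D[OF j]])
    qed
  qed simp
  then obtain R where R': "\<And>i t. i \<in> flights N \<Longrightarrow> t \<in> J i \<Longrightarrow> second_focus_radius m \<alpha> c (q i t) (p i t) = R"
    by blast
  have S: "F i \<in> sphere (complex_of_real (2 * c)) R" if i: "i \<in> flights N" for i
  proof -
    obtain t where t: "t \<in> J i" using ne[OF i] ..
    show ?thesis
      using second_focus_radius_eq(1)[OF assms(1,2) foc[OF i t], of c] R'[OF i t]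
      by (simp only: mem_sphere)
  qed
  show ?thesis
    by (intro conjI exI[of _ R] ballI R E) (fact S R')+
qed

end
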